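(* For every complex $s$ with $\mathrm{Re}(s)>0$, $$\eta(s)=\lim_{m\to\infty}\sum_{k=0}^{m}\frac{(-1)^k\,\eta(k+2)}{k!\,(m-k)!}\prod_{\substack{j=0\\ j\ne k}}^{m}(j+2-s).$$ Equivalently, $\eta(s)$ is the limit as $m\to\infty$ of the Lagrange interpolation polynomials of $\eta$ at the nodes $2,3,\dots,m+2$: $$\eta(s)=\lim_{m\to\infty}\sum_{k=0}^{m}\eta(k+2)\prod_{\substack{j=0\\ j\neq k}}^{m}\frac{s-(j+2)}{(k+2)-(j+2)}.$$
   Context: $\eta(s)=\sum_{n=1}^\infty (-1)^{n+1}n^{-s}=(1-2^{1-s})\zeta(s)$ is the Dirichlet eta function. *)

theory Defs
  imports "HOL-Analysis.Analysis"
begin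

text \<open>The Dirichlet eta function as its alternating series, with the index shifted so that the
  term for \<open>n\<close> is \<open>(-1)^((n+1)+1) (n+1)^(-s)\<close>. The series converges (conditionally, hence the
  ordered sum \<open>suminf\<close>) exactly for \<open>Re s > 0\<close>; outside this half-plane the value is meaningless
  and is not the analytic continuation.\<close>

definition dirichlet_eta :: "complex \<Rightarrow> complex" where
  "dirichlet_eta s = (\<Sum>n. (-1) ^ n * of_nat (Suc n) powr (-s))"

end

theory Submission
  imports Defs
begin

text \<open>
  With \<open>z = s - 2\<close> the nodes become \<open>0, \<dots>, m\<close>, and the Lagrange interpolation polynomial is the
  truncation after \<open>j = m\<close> of the Newton series \<open>\<Sum>\<^sub>j (z gchoose j) * D\<^sub>j\<close>, where \<open>D\<^sub>j\<close> is the
  \<open>j\<close>-th forward difference at \<open>0\<close> of \<open>k \<mapsto> \<eta>(k + 2)\<close> (\<open>lagrange_conv_newton\<close>). So the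
  claim is that this series converges to \<open>\<eta>(s)\<close> (\<open>dirichlet_eta_newton_series\<close>).

  Write \<open>x\<^sub>n = 1 / (n + 1)\<close>. Taking differences of \<open>\<eta>(k + 2) = \<Sum>\<^sub>n (-1)^n x\<^sub>n^(k + 2)\<close> gives
  \<open>D\<^sub>j = \<Sum>\<^sub>n (-1)^n x\<^sub>n^2 (x\<^sub>n - 1)^j\<close>, while for fixed \<open>n\<close> the binomial series gives
  \<open>\<Sum>\<^sub>j (z gchoose j) x\<^sub>n^2 (x\<^sub>n - 1)^j = x\<^sub>n^2 x\<^sub>n^z = (n + 1)^(-s)\<close>. The theorem is therefore
  an exchange of the sums over \<open>j\<close> and \<open>n\<close>. The double series does not converge absolutely
  for \<open>Re s \<le> 1\<close>, so the alternation in \<open>n\<close> has to be used first: since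
  \<open>u^2 (1 - u)^j\<close> has total variation \<open>O(1 / j^2)\<close> on \<open>[0, 1]\<close>, every partial sum over \<open>n\<close>
  of the alternating series for \<open>D\<^sub>j\<close> is bounded by \<open>4 / ((j + 1) (j + 2))\<close>
  (\<open>alternating_bump_sum_bound\<close>). As \<open>z gchoose j\<close> is \<open>O(j^(1 - Re s))\<close>, the terms of the
  series over \<open>j\<close> are \<open>O(j^(-1 - Re s))\<close> uniformly in the number of terms taken in \<open>n\<close>; for
  \<open>Re s > 0\<close> this is summable, and Tannery's theorem lets that number tend to infinity under the
  sum over \<open>j\<close>. The convergence of the series for \<open>\<eta>(s)\<close> comes out along the way.
\<close>

section \<open>Lagrange and Newton interpolation at the nodes 0, ..., m\<close>

lemma node_product:
  fixes z :: "'a::field_char_0"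
  assumes "k \<le> m"
  shows "(\<Prod>j\<in>{0..m} - {k}. z - of_nat j)
       = fact k * fact (m - k) * ((z gchoose k) * (z - of_nat k - 1 gchoose (m - k)))"
proof -
  have split: "{0..m} - {k} = {0..<k} \<union> {Suc k..<Suc m}"
    using assms by auto
  have "(\<Prod>j\<in>{Suc k..<Suc m}. z - of_nat j)
      = (\<Prod>i\<in>{0..<m - k}. z - of_nat k - 1 - of_nat i)"
    using assms
    by (intro prod.reindex_bij_witness[of _ "\<lambda>i. i + Suc k" "\<lambda>j. j - Suc k"])
       (auto simp: of_nat_diff algebra_simps)
  moreover have "(\<Prod>j\<in>{0..m} - {k}. z - of_nat j)
      = (\<Prod>j\<in>{0..<k}. z - of_nat j) * (\<Prod>j\<in>{Suc k..<Suc m}. z - of_nat j)"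
    unfolding split by (rule prod.union_disjoint) auto
  ultimately show ?thesis
    by (simp add: gbinomial_prod_rev)
qed

text \<open>The denominator of a Lagrange weight is its numerator at \<open>z = k\<close>.\<close>

lemma node_product_at_node:
  assumes "k \<le> m"
  shows "(\<Prod>j\<in>{0..m} - {k}. of_nat k - of_nat j :: 'a::field_char_0)
       = fact k * fact (m - k) * (-1) ^ (m - k)"
proof -
  have "(-1 :: 'a) gchoose n = (-1) ^ n" for n
    using gbinomial_minus[of "1::'a" n] by (simp flip: binomial_gbinomial)
  thus ?thesis
    using node_product[OF assms, of "of_nat k :: 'a"] by (simp flip: binomial_gbinomial)
qed

text \<open>
  Trinomial revision pulls \<open>z gchoose k\<close> out of the sum; what remains is a truncated alternating
  row \<open>\<Sum>\<^sub>i (-1)^i (z - k gchoose i)\<close>, and these have the closed form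
  \<open>(-1)^(m - k) (z - k - 1 gchoose m - k)\<close>. Both sides are thus the same product of two binomial
  coefficients, with the same sign \<open>(-1)^(m - k)\<close>.
\<close>

lemma lagrange_weight_conv_newton:
  fixes z :: "'a::field_char_0"
  assumes "k \<le> m"
  shows "(\<Prod>j\<in>{0..m} - {k}. (z - of_nat j) / (of_nat k - of_nat j))
       = (\<Sum>j=k..m. (z gchoose j) * ((-1) ^ (j - k) * of_nat (j choose k)))"
proof -
  have "(\<Sum>j=k..m. (z gchoose j) * ((-1) ^ (j - k) * of_nat (j choose k)))
      = (\<Sum>j=k..m. (z gchoose k) * ((z - of_nat k gchoose (j - k)) * (-1) ^ (j - k)))"
    using gbinomial_trinomial_revision[of k _ z]
    by (intro sum.cong) (auto simp: binomial_gbinomial mult_ac)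
  also have "\<dots> = (\<Sum>i\<le>m - k. (z gchoose k) * ((z - of_nat k gchoose i) * (-1) ^ i))"
    using assms
    by (intro sum.reindex_bij_witness[of _ "\<lambda>i. i + k" "\<lambda>j. j - k"]) auto
  also have "\<dots> = (z gchoose k) * ((-1) ^ (m - k) * (z - of_nat k - 1 gchoose (m - k)))"
    by (simp add: gbinomial_sum_lower_neg flip: sum_distrib_left)
  also have "\<dots> = (\<Prod>j\<in>{0..m} - {k}. z - of_nat j) / (\<Prod>j\<in>{0..m} - {k}. of_nat k - of_nat j)"
    unfolding node_product_at_node[OF assms] node_product[OF assms]
    by (simp add: field_simps flip: power_mult_distrib)
  finally show ?thesis by (simp add: prod_dividef)
qed

lemma lagrange_conv_newton:
  fixes z :: "'a::field_char_0"
  shows "(\<Sum>k=0..m. f k * (\<Prod>j\<in>{0..m} - {k}. (z - of_nat j) / (of_nat k - of_nat j)))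
       = (\<Sum>j\<le>m. (z gchoose j) * (\<Sum>k\<le>j. (-1) ^ (j - k) * of_nat (j choose k) * f k))"
proof -
  have "(\<Sum>k=0..m. f k * (\<Prod>j\<in>{0..m} - {k}. (z - of_nat j) / (of_nat k - of_nat j)))
      = (\<Sum>k\<le>m. \<Sum>j=k..m. (z gchoose j) * ((-1) ^ (j - k) * of_nat (j choose k) * f k))"
    unfolding atMost_atLeast0
    by (intro sum.cong refl, subst lagrange_weight_conv_newton)
       (auto simp: sum_distrib_left mult_ac)
  also have "\<dots> = (\<Sum>j\<le>m. \<Sum>k\<le>j. (z gchoose j) * ((-1) ^ (j - k) * of_nat (j choose k) * f k))"
    by (subst (1 2) sum.Sigma; (simp; fail)?)
       (rule sum.reindex_bij_witness[of _ "\<lambda>(a, b). (b, a)" "\<lambda>(a, b). (b, a)"], auto)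
  finally show ?thesis by (simp add: sum_distrib_left)
qed

section \<open>Partial sums of alternating series of bounded variation\<close>

text \<open>
  Consecutive terms are paired from the front: each pair costs at most the decrease of the majorant
  \<open>F\<close> over it, and the decreases telescope. The second hypothesis pays for an unpaired last term.
\<close>

lemma alternating_sum_bounded:
  fixes x F :: "nat \<Rightarrow> real"
  assumes "\<And>n. \<bar>x n - x (Suc n)\<bar> \<le> F n - F (Suc n)" "\<And>n. \<bar>x n\<bar> \<le> F n"
  shows "\<bar>\<Sum>n<N. (-1) ^ n * x n\<bar> \<le> F 0"
  using assms
proof (induction N arbitrary: x F rule: induct_nat_012)
  case 0
  show ?case using "0.prems"(2)[of 0] by simp
next
  case 1
  show ?case using "1.prems"(2)[of 0] by simp
next
  case (ge2 N)
  have "(\<Sum>n<Suc (Suc N). (-1) ^ n * x n)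
      = x 0 - x 1 + (\<Sum>n<N. (-1) ^ n * x (Suc (Suc n)))"
    by (simp only: sum.lessThan_Suc_shift) simp
  moreover have "\<bar>\<Sum>n<N. (-1) ^ n * x (Suc (Suc n))\<bar> \<le> F (Suc (Suc 0))"
    by (rule ge2.IH(1)) (use ge2.prems in auto)
  moreover have "\<bar>x 0 - x 1\<bar> \<le> F 0 - F 1" "\<bar>x 1 - x (Suc 1)\<bar> \<le> F 1 - F (Suc 1)"
    using ge2.prems(1)[of 0] ge2.prems(1)[of 1] by simp_all
  ultimately show ?case by simp
qed

text \<open>
  With \<open>u = 1 / (n + 1)\<close> this is, up to the sign \<open>(-1)^j\<close>, the contribution of the \<open>n\<close>-th term of
  the eta series to the \<open>j\<close>-th difference.
\<close>

definition bump :: "nat \<Rightarrow> real \<Rightarrow> real" where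
  "bump j u = u\<^sup>2 * (1 - u) ^ j"

text \<open>
  The derivative of \<open>bump j\<close> is \<open>2 u (1 - u)^j - j u^2 (1 - u)^(j - 1)\<close>, a difference of two
  functions that are nonnegative on \<open>[0, 1]\<close>. The majorant is the primitive, vanishing at \<open>0\<close>, of their
  sum, which bounds the absolute value of that derivative. Written as twice the primitive of the
  first function minus \<open>bump j\<close>, it has a closed form.
\<close>

definition bump_majorant :: "nat \<Rightarrow> real \<Rightarrow> real" where
  "bump_majorant j u =
     4 / ((real j + 1) * (real j + 2)) * (1 - (1 - u) ^ (j + 1) * (1 + (real j + 1) * u)) - bump j u"

lemma bump_variation:
  assumes "0 \<le> v" "v \<le> u" "u \<le> 1"
  shows "\<bar>bump j u - bump j v\<bar> \<le> bump_majorant j u - bump_majorant j v"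
proof -
  define c where "c = 2 / ((real j + 1) * (real j + 2))"
  define K where "K = (\<lambda>t. c * (1 - (1 - t) ^ (j + 1) * (1 + (real j + 1) * t)))"
  \<comment> \<open>\<open>K\<close> is the primitive of the first of the two nonnegative functions, and \<open>K - bump j\<close> that of
    the second; the claim says that both are nondecreasing.\<close>
  have K': "(K has_real_derivative 2 * t * (1 - t) ^ j) (at t)" for t
  proof -
    have "(K has_real_derivative
        c * ((real j + 1) * (1 - t) ^ j * (1 + (real j + 1) * t) - (real j + 1) * (1 - t) ^ (j + 1))) (at t)"
      unfolding K_def by (rule derivative_eq_intros refl)+ (simp add: algebra_simps)
    also have "c * ((real j + 1) * (1 - t) ^ j * (1 + (real j + 1) * t) - (real j + 1) * (1 - t) ^ (j + 1))
        = (c * ((real j + 1) * (real j + 2))) * t * (1 - t) ^ j"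
      by (simp add: algebra_simps)
    also have "c * ((real j + 1) * (real j + 2)) = 2"
      by (simp add: c_def)
    finally show ?thesis .
  qed
  have bump': "(bump j has_real_derivative
      2 * t * (1 - t) ^ j - real j * t\<^sup>2 * (1 - t) ^ (j - 1)) (at t)" for t
    unfolding bump_def [abs_def] by (auto intro!: derivative_eq_intros simp: algebra_simps)
  have "K v \<le> K u"
  proof (intro DERIV_nonneg_imp_nondecreasing[of v u K] exI conjI)
    fix t show "(K has_real_derivative 2 * t * (1 - t) ^ j) (at t)" by (rule K')
  qed (use assms in auto)
  moreover have "K v - bump j v \<le> K u - bump j u"
  proof (intro DERIV_nonneg_imp_nondecreasing[of v u "\<lambda>t. K t - bump j t"] exI conjI)
    fix t show "((\<lambda>t. K t - bump j t) has_real_derivative real j * t\<^sup>2 * (1 - t) ^ (j - 1)) (at t)"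
      using DERIV_diff[OF K'[of t] bump'[of t]] by simp
  qed (use assms in auto)
  moreover have "bump_majorant j t = 2 * K t - bump j t" for t
    by (simp add: bump_majorant_def K_def c_def)
  ultimately show ?thesis by (simp add: abs_le_iff)
qed

lemma alternating_bump_sum_bound:
  "\<bar>\<Sum>n<N. (-1) ^ n * bump j (1 / real (Suc n))\<bar> \<le> 4 / ((real j + 1) * (real j + 2))"
proof -
  have "\<bar>\<Sum>n<N. (-1) ^ n * bump j (1 / real (Suc n))\<bar> \<le> bump_majorant j (1 / real (Suc 0))"
  proof (rule alternating_sum_bounded)
    fix n :: nat
    show "\<bar>bump j (1 / real (Suc n)) - bump j (1 / real (Suc (Suc n)))\<bar>
        \<le> bump_majorant j (1 / real (Suc n)) - bump_majorant j (1 / real (Suc (Suc n)))"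
      by (rule bump_variation) (auto simp: field_simps)
    show "\<bar>bump j (1 / real (Suc n))\<bar> \<le> bump_majorant j (1 / real (Suc n))"
      using bump_variation[of 0 "1 / real (Suc n)" j] by (simp add: bump_def bump_majorant_def)
  qed
  also have "bump_majorant j (1 / real (Suc 0)) \<le> 4 / ((real j + 1) * (real j + 2))"
    by (simp add: bump_majorant_def bump_def)
  finally show ?thesis .
qed

section \<open>The Newton series of the eta function\<close>

text \<open>
  The asymptotics of the generalised binomial coefficient give \<open>O(j^(- Re z - 1))\<close>, so the terms
  are \<open>O(j^(- Re z - 3))\<close>. With \<open>z = s - 2\<close> the hypothesis reads \<open>Re s > 0\<close>.
\<close>

lemma gbinomial_weighted_summable:
  fixes z :: complex
  assumes "Re z > -2"
  shows "summable (\<lambda>j. cmod (z gchoose j) * (4 / ((real j + 1) * (real j + 2))))"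
proof -
  have "Bseq (\<lambda>n. (z gchoose n) / ((-1)^n / exp ((z+1) * of_real (ln (real n)))))"
    by (intro convergent_imp_Bseq convergentI[OF gbinomial_asymptotic])
  then obtain C where "C > 0"
    and C: "\<And>n. cmod ((z gchoose n) / ((-1)^n / exp ((z+1) * of_real (ln (real n))))) \<le> C"
    by (auto elim: BseqE)
  have "cmod (z gchoose j) * (4 / ((real j + 1) * (real j + 2)))
      \<le> 4 * C * real j powr (- Re z - 3)" if "j > 0" for j
  proof -
    have "cmod (z gchoose j) * real j powr (Re z + 1) \<le> C"
      using C[of j] that
      by (simp add: norm_mult norm_divide norm_power powr_def)
    hence "cmod (z gchoose j) \<le> C * real j powr (- Re z - 1)"
      using that by (simp add: powr_diff powr_minus powr_add field_simps)
    moreover have "4 / ((real j + 1) * (real j + 2)) \<le> 4 * real j powr (-2)"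
    proof -
      have "4 / ((real j + 1) * (real j + 2)) \<le> 4 / (real j * real j)"
        using that by (intro divide_left_mono mult_mono) auto
      thus ?thesis using that by (simp add: powr_minus powr_numeral power2_eq_square field_simps)
    qed
    ultimately have "cmod (z gchoose j) * (4 / ((real j + 1) * (real j + 2)))
        \<le> (C * real j powr (- Re z - 1)) * (4 * real j powr (-2))"
      using \<open>C > 0\<close> by (intro mult_mono) auto
    moreover have "- Re z - 3 = (- Re z - 1) + (-2)"
      by simp
    ultimately show ?thesis
      by (simp only: powr_add mult_ac)
  qed
  hence "eventually (\<lambda>j. norm (cmod (z gchoose j) * (4 / ((real j + 1) * (real j + 2))))
      \<le> 4 * C * real j powr (- Re z - 3)) sequentially"
    by (intro eventually_mono[OF eventually_gt_at_top[of 0]]) auto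
  moreover have "summable (\<lambda>j. 4 * C * real j powr (- Re z - 3))"
    using assms by (intro summable_mult) (simp add: summable_real_powr_iff)
  ultimately show ?thesis by (rule summable_comparison_test_ev)
qed

lemma dirichlet_eta_node_sums:
  "(\<lambda>n. (-1) ^ n * (1 / of_nat (Suc n)) ^ (k + 2)) sums dirichlet_eta (of_nat (k + 2))"
proof -
  have eq: "(of_nat (Suc n) :: complex) powr (- of_nat (k + 2)) = (1 / of_nat (Suc n)) ^ (k + 2)" for n
    unfolding powr_minus by (subst powr_nat') (simp_all add: power_one_over inverse_eq_divide del: of_nat_Suc power_Suc)
  have "summable (\<lambda>n. inverse (real n ^ (k + 2)))"
    by (rule inverse_power_summable) simp
  hence "summable (\<lambda>n. inverse (real (Suc n) ^ (k + 2)))"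
    by (subst summable_Suc_iff)
  hence "summable (\<lambda>n. cmod ((-1) ^ n * (1 / of_nat (Suc n)) ^ (k + 2)))"
    by (simp only: norm_mult norm_power norm_divide norm_of_nat norm_one norm_minus_cancel
          power_one mult_1 power_one_over inverse_eq_divide)
  thus ?thesis
    unfolding dirichlet_eta_def eq by (rule summable_sums[OF summable_norm_cancel])
qed

lemma eta_difference_sums:
  "(\<lambda>n. (-1) ^ n * ((1 / of_nat (Suc n))\<^sup>2 * (1 / of_nat (Suc n) - 1) ^ j)) sums
     (\<Sum>k\<le>j. (-1) ^ (j - k) * of_nat (j choose k) * dirichlet_eta (of_nat (k + 2)))"
proof -
  have "(\<lambda>n. \<Sum>k\<le>j. (-1) ^ (j - k) * of_nat (j choose k) * ((-1) ^ n * (1 / of_nat (Suc n)) ^ (k + 2)))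
      sums (\<Sum>k\<le>j. (-1) ^ (j - k) * of_nat (j choose k) * dirichlet_eta (of_nat (k + 2)))"
    by (intro sums_sum sums_mult dirichlet_eta_node_sums)
  moreover have "(\<Sum>k\<le>j. (-1) ^ (j - k) * of_nat (j choose k) * ((-1) ^ n * x ^ (k + 2)))
      = (-1) ^ n * (x\<^sup>2 * (x - 1) ^ j)" for n and x :: complex
    using binomial_ring[of x "-1" j]
    by (simp add: sum_distrib_left power_add power2_eq_square mult_ac)
  ultimately show ?thesis by (simp only:)
qed

text \<open>
  The binomial series for \<open>(1 + (x - 1)) powr (s - 2)\<close> with \<open>x = 1 / (n + 1)\<close>; it converges since
  \<open>-1 < x - 1 \<le> 0\<close>.
\<close>

lemma newton_series_term:
  "(\<lambda>j. (s - 2 gchoose j) * ((-1) ^ n * ((1 / of_nat (Suc n))\<^sup>2 * (1 / of_nat (Suc n) - 1) ^ j)))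
     sums ((-1) ^ n * of_nat (Suc n) powr (-s))" for s :: complex
proof -
  define x :: complex where "x = 1 / of_nat (Suc n)"
  have x: "x = of_real (1 / real (Suc n))" "x \<noteq> 0" by (simp_all add: x_def del: of_nat_Suc)
  have "norm (x - 1) < 1"
  proof -
    have "x - 1 = of_real (1 / real (Suc n) - 1)" by (simp add: x(1) del: of_nat_Suc)
    hence "norm (x - 1) = \<bar>1 / real (Suc n) - 1\<bar>" by (simp only: norm_of_real)
    also have "\<dots> < 1" by (simp add: abs_if field_simps)
    finally show ?thesis .
  qed
  from sums_mult[OF gen_binomial_complex[OF this, of "s - 2"], of "(-1) ^ n * x\<^sup>2"]
  have "(\<lambda>j. (s - 2 gchoose j) * ((-1) ^ n * (x\<^sup>2 * (x - 1) ^ j)))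
      sums ((-1) ^ n * (x\<^sup>2 * x powr (s - 2)))"
    by (simp add: mult_ac)
  also have "x\<^sup>2 * x powr (s - 2) = x powr s"
    using x(2) by (simp add: powr_diff powr_numeral)
  also have "x powr s = of_nat (Suc n) powr (-s)"
  proof -
    have "Ln x = - Ln (of_nat (Suc n))"
      unfolding x(1) using Ln_of_real[of "1 / real (Suc n)"] Ln_of_real[of "real (Suc n)"]
      by (simp add: ln_div del: of_nat_Suc)
    thus ?thesis by (simp add: powr_def x(2) del: of_nat_Suc)
  qed
  finally show ?thesis by (simp only: x_def)
qed

text \<open>
  The \<open>N\<close>-th partial sum of the series for \<open>\<eta>(s)\<close> is itself a series over \<open>j\<close>, whose terms tend to those
  of the Newton series as \<open>N\<close> grows and are dominated uniformly in \<open>N\<close> by a summable sequence.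
\<close>

lemma dirichlet_eta_newton_series:
  assumes "Re s > 0"
  shows "(\<lambda>j. (s - 2 gchoose j) *
            (\<Sum>k\<le>j. (-1) ^ (j - k) * of_nat (j choose k) * dirichlet_eta (of_nat (k + 2))))
         sums dirichlet_eta s"
proof -
  define D where "D j = (\<Sum>k\<le>j. (-1) ^ (j - k) * of_nat (j choose k) * dirichlet_eta (of_nat (k + 2)))" for j
  define t :: "nat \<Rightarrow> nat \<Rightarrow> complex"
    where "t j n = (-1) ^ n * ((1 / of_nat (Suc n))\<^sup>2 * (1 / of_nat (Suc n) - 1) ^ j)" for j n
  define M where "M j = cmod (s - 2 gchoose j) * (4 / ((real j + 1) * (real j + 2)))" for j
  have t_bound: "cmod (\<Sum>n<N. t j n) \<le> 4 / ((real j + 1) * (real j + 2))" for j N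
  proof -
    have "t j n = of_real ((-1) ^ j * ((-1) ^ n * bump j (1 / real (Suc n))))" for n
    proof -
      have "(1 / of_nat (Suc n) - 1 :: complex) ^ j = (-1) ^ j * (1 - 1 / of_nat (Suc n)) ^ j"
        by (simp flip: power_mult_distrib)
      thus ?thesis by (simp add: t_def bump_def)
    qed
    hence "(\<Sum>n<N. t j n) = of_real ((-1) ^ j *
        (\<Sum>n<N. (-1) ^ n * bump j (1 / real (Suc n))))"
      by (simp only: of_real_sum sum_distrib_left)
    hence "cmod (\<Sum>n<N. t j n)
        = \<bar>\<Sum>n<N. (-1) ^ n * bump j (1 / real (Suc n))\<bar>"
      by (simp only: norm_of_real abs_mult power_abs) simp
    thus ?thesis using alternating_bump_sum_bound[where N = N and j = j] by simp
  qed
  have "eventually (\<lambda>N. summable (\<lambda>j. cmod ((s - 2 gchoose j) * (\<Sum>n<N. t j n)))) sequentially \<and>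
      summable (\<lambda>j. cmod ((s - 2 gchoose j) * D j)) \<and>
      ((\<lambda>N. \<Sum>j. (s - 2 gchoose j) * (\<Sum>n<N. t j n)) \<longlonglongrightarrow> (\<Sum>j. (s - 2 gchoose j) * D j))"
  proof (rule tannerys_theorem)
    show "(\<lambda>N. (s - 2 gchoose j) * (\<Sum>n<N. t j n)) \<longlonglongrightarrow> (s - 2 gchoose j) * D j" for j
      using eta_difference_sums[of j] unfolding sums_def D_def t_def by (intro tendsto_mult_left)
    show "eventually (\<lambda>(j, N). cmod ((s - 2 gchoose j) * (\<Sum>n<N. t j n)) \<le> M j)
        (at_top \<times>\<^sub>F sequentially)"
      unfolding M_def norm_mult by (intro always_eventually) (auto intro!: mult_left_mono t_bound simp del: times_divide_eq_right)
    show "summable M"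
      unfolding M_def using assms by (intro gbinomial_weighted_summable) simp
  qed auto
  hence abs_summ: "summable (\<lambda>j. cmod ((s - 2 gchoose j) * D j))"
    and lim: "(\<lambda>N. \<Sum>j. (s - 2 gchoose j) * (\<Sum>n<N. t j n)) \<longlonglongrightarrow> (\<Sum>j. (s - 2 gchoose j) * D j)"
    by blast+
  from abs_summ have summ: "summable (\<lambda>j. (s - 2 gchoose j) * D j)"
    by (rule summable_norm_cancel)
  have "(\<lambda>j. (s - 2 gchoose j) * (\<Sum>n<N. t j n)) sums (\<Sum>n<N. (-1) ^ n * of_nat (Suc n) powr (-s))" for N
    unfolding sum_distrib_left t_def by (intro sums_sum newton_series_term)
  hence "(\<Sum>j. (s - 2 gchoose j) * (\<Sum>n<N. t j n)) = (\<Sum>n<N. (-1) ^ n * of_nat (Suc n) powr (-s))" for N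
    by (simp only: sums_iff)
  with lim have "(\<lambda>n. (-1) ^ n * of_nat (Suc n) powr (-s)) sums (\<Sum>j. (s - 2 gchoose j) * D j)"
    by (simp add: sums_def)
  hence "dirichlet_eta s = (\<Sum>j. (s - 2 gchoose j) * D j)"
    by (simp only: dirichlet_eta_def sums_iff)
  with summ show ?thesis
    by (simp add: D_def summable_sums)
qed

theorem mainTheorem4:
  fixes s :: complex
  assumes "Re s > 0"
  shows "((\<lambda>m::nat. \<Sum>k=0..m.
             (-1) ^ k * dirichlet_eta (of_nat (k + 2)) / (fact k * fact (m - k))
               * (\<Prod>j\<in>{0..m} - {k}. of_nat (j + 2) - s))
           \<longlonglongrightarrow> dirichlet_eta s)
       \<and> ((\<lambda>m::nat. \<Sum>k=0..m.
             dirichlet_eta (of_nat (k + 2))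
               * (\<Prod>j\<in>{0..m} - {k}.
                    (s - of_nat (j + 2)) / (of_nat (k + 2) - of_nat (j + 2))))
           \<longlonglongrightarrow> dirichlet_eta s)"
proof -
  define L where "L m = (\<Sum>k=0..m. dirichlet_eta (of_nat (k + 2))
      * (\<Prod>j\<in>{0..m} - {k}. (s - of_nat (j + 2)) / (of_nat (k + 2) - of_nat (j + 2))))" for m
  have "L m = (\<Sum>k=0..m. dirichlet_eta (of_nat (k + 2))
      * (\<Prod>j\<in>{0..m} - {k}. (s - 2 - of_nat j) / (of_nat k - of_nat j)))" for m
    by (simp add: L_def algebra_simps)
  hence "L = (\<lambda>m. \<Sum>j\<le>m. (s - 2 gchoose j) *
      (\<Sum>k\<le>j. (-1) ^ (j - k) * of_nat (j choose k) * dirichlet_eta (of_nat (k + 2))))"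
    by (simp only: lagrange_conv_newton fun_eq_iff) simp
  hence L_lim: "L \<longlonglongrightarrow> dirichlet_eta s"
    using dirichlet_eta_newton_series[OF assms] by (simp only: sums_def_le)
  have weight: "(\<Prod>j\<in>{0..m} - {k}. (s - of_nat (j + 2)) / (of_nat (k + 2) - of_nat (j + 2)))
      = (-1) ^ k / (fact k * fact (m - k)) * (\<Prod>j\<in>{0..m} - {k}. of_nat (j + 2) - s)"
    if "k \<le> m" for k m
  proof -
    have "(\<Prod>j\<in>{0..m} - {k}. s - of_nat (j + 2)) = (\<Prod>j\<in>{0..m} - {k}. (-1) * (of_nat (j + 2) - s))"
      by simp
    also have "\<dots> = (-1) ^ m * (\<Prod>j\<in>{0..m} - {k}. of_nat (j + 2) - s)"
      using that by (subst prod.distrib) (simp add: card_Diff_singleton)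
    also have "(-1) ^ m = (-1 :: complex) ^ k * (-1) ^ (m - k)"
      using that by (simp flip: power_add)
    finally show ?thesis
      using node_product_at_node[OF that, where 'a = complex]
      by (simp add: prod_dividef field_simps flip: power_add)
  qed
  have "L m = (\<Sum>k=0..m. (-1) ^ k * dirichlet_eta (of_nat (k + 2)) / (fact k * fact (m - k))
               * (\<Prod>j\<in>{0..m} - {k}. of_nat (j + 2) - s))" for m
    unfolding L_def by (intro sum.cong refl, subst weight) auto
  hence L_eq: "L = (\<lambda>m. \<Sum>k=0..m. (-1) ^ k * dirichlet_eta (of_nat (k + 2)) / (fact k * fact (m - k))
               * (\<Prod>j\<in>{0..m} - {k}. of_nat (j + 2) - s))" ..
  show ?thesis
    using L_lim L_lim[unfolded L_eq] unfolding L_def by (intro conjI)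
qed

end
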